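(* Let $R$ be an associative ring with unit element $1\neq 0$, and let $q\in\mathbb{P}(R)$ be a point of the projective line over $R$. Then the point $R(1,0)$ is radically parallel to $q$ if, and only if, there is an element $b$ in the Jacobson radical $\mathrm{rad}\,R$ such that $q=R(1,b)$.
   Context: All rings are associative with unit element $1\neq 0$. $\mathrm{GL}_2(R)$ is the group of invertible $2\times 2$-matrices over $R$, acting from the right on row vectors in the free left $R$-module $R^2$. A pair $(a,b)\in R^2$ is admissible if it is the first row of some matrix in $\mathrm{GL}_2(R)$. The projective line over $R$ is $\mathbb{P}(R):=\{R(a,b)\mid (a,b)\in R^2 \text{ admissible}\}$, i.e. the orbit of the cyclic submodule $R(1,0)$ of $R^2$ under $\mathrm{GL}_2(R)$; points are always represented by admissible pairs. Two points $p=R(a,b)$, $q=R(c,d)$ (with $(a,b),(c,d)$ admissible) are called distant, written $p\mathrel{\triangle} q$, if $\begin{pmatrix}a&b\\c&d\end{pmatrix}\in\mathrm{GL}_2(R)$; equivalently, $\triangle$ is the orbit of the pair $(R(1,0),R(0,1))$ under $\mathrm{GL}_2(R)$. A point $p\in\mathbb{P}(R)$ is called radically parallel to a point $q\in\mathbb{P}(R)$, written $p\parallel q$, if for all $x\in\mathbb{P}(R)$: $x\mathrel{\triangle} p$ implies $x\mathrel{\triangle} q$. The Jacobson radical $\mathrm{rad}\,R$ is the intersection of all maximal left (equivalently, right) ideals of $R$. *)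

theory Defs
  imports "HOL-Analysis.Analysis"
begin

text \<open>
  The ring \<open>R\<close> is the universe of a type of class \<^class>\<open>ring_1\<close> (associative, unital,
  \<open>1 \<noteq> 0\<close>, not necessarily commutative). Elements of \<open>R\<^sup>2\<close> are row vectors of type
  \<open>'a^2\<close>, with scalars acting on the left by \<open>*s\<close> and matrices on the right by \<open>v*\<close>;
  \<open>GL\<^sub>2(R)\<close> is the set of \<open>A :: 'a^2^2\<close> with \<open>invertible A\<close> (two-sided inverse).
\<close>

definition cyclic_submodule :: "'a::ring_1 ^ 2 \<Rightarrow> ('a ^ 2) set" where
  "cyclic_submodule v = {r *s v | r. True}"

definition admissible :: "'a::ring_1 ^ 2 \<Rightarrow> bool" where
  "admissible v \<longleftrightarrow> (\<exists>A :: 'a ^ 2 ^ 2. invertible A \<and> row 1 A = v)"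

definition projective_line :: "('a::ring_1 ^ 2) set set" where
  "projective_line = {cyclic_submodule v | v. admissible v}"

text \<open>
  The choice of admissible representatives in the next definition is immaterial, see
  \<open>distant_cyclic_iff\<close> below.
\<close>

definition distant :: "('a::ring_1 ^ 2) set \<Rightarrow> ('a ^ 2) set \<Rightarrow> bool" where
  "distant p q \<longleftrightarrow> (\<exists>u v. admissible u \<and> admissible v \<and>
     p = cyclic_submodule u \<and> q = cyclic_submodule v \<and>
     invertible (vector [u, v] :: 'a ^ 2 ^ 2))"

definition radically_parallel :: "('a::ring_1 ^ 2) set \<Rightarrow> ('a ^ 2) set \<Rightarrow> bool" where
  "radically_parallel p q \<longleftrightarrow> (\<forall>x\<in>projective_line. distant x p \<longrightarrow> distant x q)"

text \<open>Closure under negation follows from \<open>- x = (- 1) * x\<close>.\<close>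

definition left_ideal :: "'a::ring_1 set \<Rightarrow> bool" where
  "left_ideal I \<longleftrightarrow> 0 \<in> I \<and> (\<forall>x\<in>I. \<forall>y\<in>I. x + y \<in> I) \<and> (\<forall>r. \<forall>x\<in>I. r * x \<in> I)"

definition maximal_left_ideal :: "'a::ring_1 set \<Rightarrow> bool" where
  "maximal_left_ideal M \<longleftrightarrow> left_ideal M \<and> M \<noteq> UNIV \<and>
     (\<forall>I. left_ideal I \<and> M \<subseteq> I \<longrightarrow> I = M \<or> I = UNIV)"

definition jacobson_radical :: "'a::ring_1 set" where
  "jacobson_radical = \<Inter>{M. maximal_left_ideal M}"

lemma cyclic_submodule_vm:
  "(\<lambda>x. x v* A) ` cyclic_submodule (vector [1, 0]) = cyclic_submodule (row 1 A)"
  for A :: "'a::ring_1 ^ 2 ^ 2"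
proof -
  have "(r *s vector [1, 0]) v* A = r *s row 1 A" for r
    by (simp add: vec_eq_iff vector_matrix_mult_def row_def sum_2)
  then show ?thesis
    by (auto simp: cyclic_submodule_def image_iff) metis
qed

text \<open>The projective line is the orbit of \<open>R(1,0)\<close> under \<open>GL\<^sub>2(R)\<close>.\<close>

lemma projective_line_orbit:
  "projective_line = {(\<lambda>x. x v* A) ` cyclic_submodule (vector [1, 0]) | A :: 'a::ring_1 ^ 2 ^ 2. invertible A}"
  by (auto simp: projective_line_def admissible_def cyclic_submodule_vm)

lemma admissible_smult_cancel:
  fixes u :: "'a::ring_1 ^ 2"
  assumes "admissible u" "c *s u = u"
  shows "c = 1"
proof -
  obtain A B :: "'a ^ 2 ^ 2" where A: "A ** B = mat 1" "row 1 A = u"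
    using assms(1) by (auto simp: admissible_def invertible_def)
  have 1: "u $ 1 * B $ 1 $ 1 + u $ 2 * B $ 2 $ 1 = 1"
    using arg_cong[OF A(1), of "\<lambda>M. M $ 1 $ 1"]
    by (simp add: matrix_matrix_mult_def sum_2 mat_def flip: A(2)) (simp add: row_def)
  have "c * u $ i = u $ i" for i
    using assms(2) by (metis vector_smult_component)
  then have "c * (u $ 1 * B $ 1 $ 1 + u $ 2 * B $ 2 $ 1) = u $ 1 * B $ 1 $ 1 + u $ 2 * B $ 2 $ 1"
    by (simp add: distrib_left flip: mult.assoc)
  then show ?thesis by (simp add: 1)
qed

lemma cyclic_submodule_eqD:
  fixes u v :: "'a::ring_1 ^ 2"
  assumes "admissible u" "admissible v" "cyclic_submodule u = cyclic_submodule v"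
  shows "\<exists>c d. u = c *s v \<and> c * d = 1 \<and> d * c = 1"
proof -
  have "w \<in> cyclic_submodule w" for w :: "'a ^ 2"
    unfolding cyclic_submodule_def by (metis (mono_tags, lifting) mem_Collect_eq vector_smult_lid)
  then have "u \<in> cyclic_submodule v" "v \<in> cyclic_submodule u"
    using assms(3) by blast+
  then obtain c d where cd: "u = c *s v" "v = d *s u"
    unfolding cyclic_submodule_def by blast
  have "(c * d) *s u = u" "(d * c) *s v = v"
    using cd by (metis vector_smult_assoc)+
  then show ?thesis
    using admissible_smult_cancel assms(1,2) cd by metis
qed

lemma distant_cyclic_iff:
  fixes u v :: "'a::ring_1 ^ 2"
  assumes "admissible u" "admissible v"
  shows "distant (cyclic_submodule u) (cyclic_submodule v) \<longleftrightarrow>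
           invertible (vector [u, v] :: 'a ^ 2 ^ 2)"
proof
  assume "distant (cyclic_submodule u) (cyclic_submodule v)"
  then obtain u' v' where *: "admissible u'" "admissible v'"
      "cyclic_submodule u = cyclic_submodule u'" "cyclic_submodule v = cyclic_submodule v'"
      and inv: "invertible (vector [u', v'] :: 'a ^ 2 ^ 2)"
    by (auto simp: distant_def)
  obtain c d where c: "u = c *s u'" "c * d = 1" "d * c = 1"
    using cyclic_submodule_eqD assms(1) *(1,3) by metis
  obtain e f where e: "v = e *s v'" "e * f = 1" "f * e = 1"
    using cyclic_submodule_eqD assms(2) *(2,4) by metis
  define D E :: "'a ^ 2 ^ 2"
    where "D = vector [vector [c, 0], vector [0, e]]"
      and "E = vector [vector [d, 0], vector [0, f]]"
  have "D ** E = mat 1" "E ** D = mat 1"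
    using c e by (auto simp: D_def E_def vec_eq_iff forall_2 matrix_matrix_mult_def sum_2 mat_def)
  then have "invertible D" by (auto simp: invertible_def)
  moreover have "(vector [u, v] :: 'a ^ 2 ^ 2) = D ** vector [u', v']"
    by (simp add: D_def c(1) e(1) vec_eq_iff forall_2 matrix_matrix_mult_def sum_2)
  ultimately show "invertible (vector [u, v] :: 'a ^ 2 ^ 2)"
    using inv by (simp add: invertible_mult)
next
  assume "invertible (vector [u, v] :: 'a ^ 2 ^ 2)"
  then show "distant (cyclic_submodule u) (cyclic_submodule v)"
    using assms by (auto simp: distant_def)
qed

end

theory Submission
  imports Defs
begin

text \<open>
  The points distant from \<open>R(1,0)\<close> are exactly the \<open>R(x,1)\<close> with \<open>x \<in> R\<close>, and \<open>R(x,1)\<close> is distant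
  from \<open>R(c,d)\<close> iff \<open>c - d x\<close> is a unit. So \<open>R(1,0)\<close> is radically parallel to \<open>R(c,d)\<close> iff \<open>c - d x\<close>
  is a unit for every \<open>x\<close>. Taking \<open>x = 0\<close> shows that \<open>c\<close> is a unit, which normalises the point to
  \<open>R(1,b)\<close>; then \<open>1 - b x\<close> is a unit for every \<open>x\<close>, which characterises \<open>b \<in> rad R\<close>.
\<close>

section \<open>Two-sided units of a noncommutative ring\<close>

definition ring_unit :: "'a::ring_1 \<Rightarrow> bool" where
  "ring_unit u \<longleftrightarrow> (\<exists>v. u * v = 1 \<and> v * u = 1)"

lemma ring_unit_mult:
  assumes "ring_unit a" "ring_unit b"
  shows "ring_unit (a * b)"
proof -
  obtain a' b' where "a * a' = 1" "a' * a = 1" "b * b' = 1" "b' * b = 1"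
    using assms by (auto simp: ring_unit_def)
  then have "(a * b) * (b' * a') = 1" "(b' * a') * (a * b) = 1"
    by (metis mult.assoc mult_1_right)+
  then show ?thesis by (auto simp: ring_unit_def)
qed

text \<open>If \<open>c\<close> inverts \<open>1 - a * b\<close>, then \<open>1 + b * c * a\<close>
  inverts \<open>1 - b * a\<close>; the formula is suggested by the formal geometric series of
  \<open>b * a\<close>.\<close>

lemma ring_unit_one_minus_mult_swap:
  fixes a b :: "'a::ring_1"
  assumes "ring_unit (1 - a * b)"
  shows "ring_unit (1 - b * a)"
proof -
  obtain c where c: "(1 - a * b) * c = 1" "c * (1 - a * b) = 1"
    using assms by (auto simp: ring_unit_def)
  have "(1 - b * a) * (1 + b * c * a) = 1 - b * a + b * ((1 - a * b) * c) * a"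
    by (simp add: algebra_simps)
  moreover have "(1 + b * c * a) * (1 - b * a) = 1 - b * a + b * (c * (1 - a * b)) * a"
    by (simp add: algebra_simps)
  ultimately show ?thesis
    unfolding ring_unit_def c by (metis diff_add_cancel mult_1_right)
qed

section \<open>The Jacobson radical\<close>

lemma left_ideal_UNIV_iff:
  assumes "left_ideal I"
  shows "I = UNIV \<longleftrightarrow> 1 \<in> I"
  using assms unfolding left_ideal_def by (metis UNIV_I UNIV_eq_I mult_1_right)

lemma left_ideal_principal: "left_ideal (range (\<lambda>r::'a::ring_1. r * a))"
  unfolding left_ideal_def
proof (intro conjI ballI allI)
  show "0 \<in> range (\<lambda>r. r * a)"
    by (metis mult_zero_left rangeI)
next
  fix x y assume "x \<in> range (\<lambda>r. r * a)" "y \<in> range (\<lambda>r. r * a)"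
  then show "x + y \<in> range (\<lambda>r. r * a)"
    by (auto simp flip: distrib_right)
next
  fix r x assume "x \<in> range (\<lambda>r. r * a)"
  then show "r * x \<in> range (\<lambda>r. r * a)"
    by (auto simp flip: mult.assoc)
qed

lemma left_ideal_sum:
  assumes "left_ideal I" "left_ideal J"
  shows "left_ideal {x + y | x y. x \<in> I \<and> y \<in> J}"
  unfolding left_ideal_def
proof (intro conjI ballI allI)
  show "0 \<in> {x + y | x y. x \<in> I \<and> y \<in> J}"
    using assms by (auto simp: left_ideal_def intro!: exI[of _ 0])
next
  fix s t assume "s \<in> {x + y | x y. x \<in> I \<and> y \<in> J}" "t \<in> {x + y | x y. x \<in> I \<and> y \<in> J}"
  then obtain x y x' y' where "s = x + y" "t = x' + y'" "x \<in> I" "y \<in> J" "x' \<in> I" "y' \<in> J"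
    by blast
  moreover from this have "s + t = (x + x') + (y + y')"
    by simp
  ultimately show "s + t \<in> {x + y | x y. x \<in> I \<and> y \<in> J}"
    using assms unfolding left_ideal_def by blast
next
  fix r s assume "s \<in> {x + y | x y. x \<in> I \<and> y \<in> J}"
  then obtain x y where "s = x + y" "x \<in> I" "y \<in> J"
    by blast
  then show "r * s \<in> {x + y | x y. x \<in> I \<and> y \<in> J}"
    using assms unfolding left_ideal_def by (metis (mono_tags, lifting) distrib_left mem_Collect_eq)
qed

lemma left_ideal_Union_chain:
  assumes "C \<noteq> {}" "\<And>I. I \<in> C \<Longrightarrow> left_ideal I"
    and "\<And>I J. I \<in> C \<Longrightarrow> J \<in> C \<Longrightarrow> I \<subseteq> J \<or> J \<subseteq> I"
  shows "left_ideal (\<Union>C)"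
  unfolding left_ideal_def
proof (intro conjI ballI allI)
  show "0 \<in> \<Union>C"
    using assms(1,2) by (auto simp: left_ideal_def)
next
  fix x y assume "x \<in> \<Union>C" "y \<in> \<Union>C"
  then obtain I where "I \<in> C" "x \<in> I" "y \<in> I"
    using assms(3) by blast
  then show "x + y \<in> \<Union>C"
    using assms(2) by (auto simp: left_ideal_def)
next
  fix r x assume "x \<in> \<Union>C"
  then show "r * x \<in> \<Union>C"
    using assms(2) unfolding left_ideal_def by blast
qed

text \<open>Zorn's lemma, with properness expressed as \<open>1 \<notin> J\<close>, a condition that
  passes to unions of chains.\<close>

lemma ex_maximal_left_ideal:
  fixes I :: "'a::ring_1 set"
  assumes I: "left_ideal I" "1 \<notin> I"
  shows "\<exists>M. maximal_left_ideal M \<and> I \<subseteq> M"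
proof -
  let ?A = "{J. left_ideal J \<and> 1 \<notin> J \<and> I \<subseteq> J}"
  have "\<exists>M\<in>?A. \<forall>X\<in>?A. M \<subseteq> X \<longrightarrow> X = M"
  proof (rule subset_Zorn_nonempty)
    show "?A \<noteq> {}" using I by blast
  next
    fix C assume C: "C \<noteq> {}" "subset.chain ?A C"
    have "left_ideal (\<Union>C)"
      using C by (intro left_ideal_Union_chain) (auto simp: subset_chain_def)
    then show "\<Union>C \<in> ?A"
      using C by (auto simp: subset_chain_def)
  qed
  then obtain M where M: "left_ideal M" "1 \<notin> M" "I \<subseteq> M"
      and max: "\<And>X. left_ideal X \<Longrightarrow> 1 \<notin> X \<Longrightarrow> M \<subseteq> X \<Longrightarrow> X = M"
    by (smt (verit) mem_Collect_eq subset_trans)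
  have "maximal_left_ideal M"
    unfolding maximal_left_ideal_def
    using M(1,2) max left_ideal_UNIV_iff by blast
  with M(3) show ?thesis by blast
qed

text \<open>Otherwise the left ideal generated by \<open>1 - x * b\<close> is proper and lies in a
  maximal left ideal \<open>M\<close>. Since \<open>M\<close> also contains \<open>b\<close>, it
  would contain 1.\<close>

lemma jacobson_radical_left_inverse:
  fixes b :: "'a::ring_1"
  assumes "b \<in> jacobson_radical"
  shows "\<exists>u. u * (1 - x * b) = 1"
proof (rule ccontr)
  assume "\<nexists>u. u * (1 - x * b) = 1"
  then have "1 \<notin> range (\<lambda>r. r * (1 - x * b))"
    by (metis rangeE)
  then obtain M where M: "maximal_left_ideal M" "range (\<lambda>r. r * (1 - x * b)) \<subseteq> M"
    using ex_maximal_left_ideal[OF left_ideal_principal] by blast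
  have "left_ideal M" "1 \<notin> M"
    using M(1) left_ideal_UNIV_iff by (auto simp: maximal_left_ideal_def)
  moreover have "b \<in> M"
    using assms M(1) by (auto simp: jacobson_radical_def)
  moreover have "1 - x * b \<in> M"
    using M(2) by (metis mult_1_left rangeI subsetD)
  ultimately have "(1 - x * b) + x * b \<in> M"
    unfolding left_ideal_def by blast
  with \<open>1 \<notin> M\<close> show False by simp
qed

text \<open>Left inverses become two-sided by applying the previous lemma twice. Conversely, if a
  maximal left ideal \<open>M\<close> misses \<open>b\<close>, then \<open>M + R b\<close> is the
  whole ring, so \<open>M\<close> contains some unit \<open>1 - x * b\<close>, which is
  absurd.\<close>

lemma jacobson_radical_iff_left:
  fixes b :: "'a::ring_1"
  shows "b \<in> jacobson_radical \<longleftrightarrow> (\<forall>x. ring_unit (1 - x * b))"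
proof (intro iffI allI)
  fix x assume b: "b \<in> jacobson_radical"
  obtain u where u: "u * (1 - x * b) = 1"
    using jacobson_radical_left_inverse[OF b] by blast
  \<comment> \<open>The left inverse \<open>u = 1 + u x b\<close> has the same shape, so it is itself left invertible.\<close>
  have "u = 1 - (- (u * x)) * b"
    using u by (simp add: algebra_simps)
  then obtain v where v: "v * u = 1"
    using jacobson_radical_left_inverse[OF b] by metis
  \<comment> \<open>Both \<open>v\<close> and \<open>1 - x * b\<close> are inverse to
    \<open>u\<close>, one from the left and the other from the right, so they coincide.\<close>
  have "v = 1 - x * b"
    using u v by (metis mult.assoc mult_1_left mult_1_right)
  with u v show "ring_unit (1 - x * b)"
    by (auto simp: ring_unit_def)
next
  assume units: "\<forall>x. ring_unit (1 - x * b)"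
  have "b \<in> M" if M: "maximal_left_ideal M" for M
  proof (rule ccontr)
    assume "b \<notin> M"
    let ?J = "{m + y | m y. m \<in> M \<and> y \<in> range (\<lambda>r. r * b)}"
    have lM: "left_ideal M" "1 \<notin> M"
      using M left_ideal_UNIV_iff by (auto simp: maximal_left_ideal_def)
    have "left_ideal ?J"
      by (intro left_ideal_sum lM left_ideal_principal)
    moreover have "M \<subseteq> ?J"
    proof
      fix m assume "m \<in> M"
      moreover have "m = m + 0 * b" by simp
      ultimately show "m \<in> ?J" by blast
    qed
    moreover have "b \<in> ?J"
    proof -
      have "b = 0 + 1 * b" by simp
      then show ?thesis using lM(1) unfolding left_ideal_def by blast
    qed
    ultimately have "?J = UNIV"
      using M \<open>b \<notin> M\<close> unfolding maximal_left_ideal_def by blast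
    then have "1 \<in> ?J" by simp
    then obtain m x where m: "m \<in> M" "1 = m + x * b"
      by blast
    then have "m = 1 - x * b" by (simp add: eq_diff_eq)
    then obtain v where "v * m = 1"
      using units by (auto simp: ring_unit_def)
    with lM m(1) show False
      unfolding left_ideal_def by metis
  qed
  then show "b \<in> jacobson_radical"
    by (auto simp: jacobson_radical_def)
qed

text \<open>The radical is defined by left ideals, which puts the free factor \<open>x\<close> to
  the left of \<open>b\<close>; the elements \<open>c - d * x\<close> from the projective line have
  it on the right.\<close>

lemma jacobson_radical_iff_right:
  fixes b :: "'a::ring_1"
  shows "b \<in> jacobson_radical \<longleftrightarrow> (\<forall>x. ring_unit (1 - b * x))"
  unfolding jacobson_radical_iff_left using ring_unit_one_minus_mult_swap by blast

section \<open>Points distant from \<open>R(1,0)\<close>\<close>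

text \<open>The witnesses are the entries of the inverse, row by row. As there is no determinant
  criterion over a noncommutative ring, both matrix products are spelled out.\<close>

lemma invertible_2x2_iff:
  fixes a b c d :: "'a::ring_1"
  shows "invertible (vector [vector [a, b], vector [c, d]] :: 'a ^ 2 ^ 2) \<longleftrightarrow>
    (\<exists>p q r s. a * p + b * r = 1 \<and> a * q + b * s = 0 \<and> c * p + d * r = 0 \<and> c * q + d * s = 1 \<and>
               p * a + q * c = 1 \<and> p * b + q * d = 0 \<and> r * a + s * c = 0 \<and> r * b + s * d = 1)"
    (is "invertible ?A \<longleftrightarrow> ?R")
proof
  assume "invertible ?A"
  then obtain B where "?A ** B = mat 1" "B ** ?A = mat 1"
    by (auto simp: invertible_def)
  then show ?R
    by (intro exI[of _ "B $ 1 $ 1"] exI[of _ "B $ 1 $ 2"] exI[of _ "B $ 2 $ 1"] exI[of _ "B $ 2 $ 2"])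
      (simp add: vec_eq_iff forall_2 matrix_matrix_mult_def sum_2 mat_def)
next
  assume ?R
  then obtain p q r s where "a * p + b * r = 1" "a * q + b * s = 0" "c * p + d * r = 0"
    "c * q + d * s = 1" "p * a + q * c = 1" "p * b + q * d = 0" "r * a + s * c = 0" "r * b + s * d = 1"
    by blast
  then show "invertible ?A"
    unfolding invertible_def
    by (intro exI[of _ "vector [vector [p, q], vector [r, s]]"])
      (simp add: vec_eq_iff forall_2 matrix_matrix_mult_def sum_2 mat_def)
qed

text \<open>Subtracting the second column times \<open>x\<close> from the first leaves the rows
  \<open>(0, 1)\<close> and \<open>(c - d * x, d)\<close>. In the proof, the upper right entry
  \<open>q\<close> of the inverse is the inverse of \<open>c - d * x\<close>.\<close>

lemma invertible_x_1_iff: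
  fixes x c d :: "'a::ring_1"
  shows "invertible (vector [vector [x, 1], vector [c, d]] :: 'a ^ 2 ^ 2) \<longleftrightarrow> ring_unit (c - d * x)"
proof
  assume "invertible (vector [vector [x, 1], vector [c, d]] :: 'a ^ 2 ^ 2)"
  then obtain p q s where *: "x * q + s = 0" "c * q + d * s = 1" "p * x + q * c = 1" "p + q * d = 0"
    unfolding invertible_2x2_iff by auto
  have "s = - (x * q)" "p = - (q * d)"
    using * by (simp_all add: eq_neg_iff_add_eq_0 add.commute)
  then have "(c - d * x) * q = 1" "q * (c - d * x) = 1"
    using * by (simp_all add: algebra_simps)
  then show "ring_unit (c - d * x)"
    by (auto simp: ring_unit_def)
next
  assume "ring_unit (c - d * x)"
  then obtain q where q: "(c - d * x) * q = 1" "q * (c - d * x) = 1"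
    by (auto simp: ring_unit_def)
  \<comment> \<open>The inverse is determined by \<open>q\<close>: as in the other direction
    \<open>p = - (q * d)\<close> and \<open>s = - (x * q)\<close>, and \<open>x * p + r = 1\<close>
    yields \<open>r\<close>. Two of the required equations are prepared here.\<close>
  have "c * - (q * d) + d * (1 + x * q * d) = d - (c - d * x) * q * d"
    by (simp add: algebra_simps)
  then have 1: "c * - (q * d) + d * (1 + x * q * d) = 0"
    by (simp add: q)
  have "(1 + x * q * d) * x + - (x * q) * c = x - x * (q * (c - d * x))"
    by (simp add: algebra_simps)
  then have 2: "(1 + x * q * d) * x + - (x * q) * c = 0"
    by (simp add: q)
  show "invertible (vector [vector [x, 1], vector [c, d]] :: 'a ^ 2 ^ 2)"
    unfolding invertible_2x2_iff
    using q 1 2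
    by (intro exI[of _ "- (q * d)"] exI[of _ q] exI[of _ "1 + x * q * d"] exI[of _ "- (x * q)"])
      (simp add: algebra_simps)
qed

lemma vector_2_eta: "vector [v $ 1, v $ 2] = (v :: 'a::zero ^ 2)"
  by (simp add: vec_eq_iff forall_2)

lemma admissibleI:
  "invertible (vector [u, v] :: 'a::ring_1 ^ 2 ^ 2) \<Longrightarrow> admissible u"
  unfolding admissible_def by (rule exI[of _ "vector [u, v]"]) (simp add: row_def vec_eq_iff)

lemma admissible_x_1: "admissible (vector [x, 1] :: 'a::ring_1 ^ 2)"
  by (rule admissibleI[of _ "vector [1, 0]"]) (auto simp: invertible_x_1_iff ring_unit_def)

lemma admissible_1_x: "admissible (vector [1, x] :: 'a::ring_1 ^ 2)"
  by (rule admissibleI[of _ "vector [0, 1]"])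
    (unfold invertible_2x2_iff, intro exI[of _ 1] exI[of _ "- x"] exI[of _ 0], simp)

lemma cyclic_submodule_unit_smult:
  assumes "ring_unit e"
  shows "cyclic_submodule (e *s v) = cyclic_submodule v"
proof -
  obtain f where f: "f * e = 1"
    using assms by (auto simp: ring_unit_def)
  have "r *s v = (r * f) *s (e *s v)" for r
    by (simp add: vector_smult_assoc mult.assoc f)
  then show ?thesis
    unfolding cyclic_submodule_def by (auto simp: vector_smult_assoc)
qed

lemma distant_1_0_iff:
  fixes p :: "('a::ring_1 ^ 2) set"
  shows "distant p (cyclic_submodule (vector [1, 0])) \<longleftrightarrow> (\<exists>x. p = cyclic_submodule (vector [x, 1]))"
proof
  assume dist: "distant p (cyclic_submodule (vector [1, 0]))"
  then obtain u where u: "admissible u" "p = cyclic_submodule u"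
    by (auto simp: distant_def)
  have "invertible (vector [vector [u $ 1, u $ 2], vector [1, 0]] :: 'a ^ 2 ^ 2)"
    using dist u by (simp add: distant_cyclic_iff admissible_1_x vector_2_eta)
  \<comment> \<open>The second row \<open>(1, 0)\<close> forces \<open>p' = 0\<close>, so the lower
    left entry \<open>r\<close> of the inverse matrix is a two-sided inverse of
    \<open>u $ 2\<close>. Scaling by it normalises the second coordinate to 1.\<close>
  then obtain p' q' r s where "u $ 1 * p' + u $ 2 * r = 1" "p' = 0" "r * u $ 2 = 1"
    unfolding invertible_2x2_iff by auto
  then have r: "u $ 2 * r = 1" "r * u $ 2 = 1"
    by auto
  then have "ring_unit (u $ 2)"
    by (auto simp: ring_unit_def)
  moreover have "u = u $ 2 *s vector [r * u $ 1, 1]"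
    by (simp add: vec_eq_iff forall_2 r flip: mult.assoc)
  ultimately have "p = cyclic_submodule (vector [r * u $ 1, 1])"
    using u(2) cyclic_submodule_unit_smult by metis
  then show "\<exists>x. p = cyclic_submodule (vector [x, 1])" ..
next
  assume "\<exists>x. p = cyclic_submodule (vector [x, 1])"
  then show "distant p (cyclic_submodule (vector [1, 0]))"
    by (auto simp: distant_cyclic_iff admissible_x_1 admissible_1_x invertible_x_1_iff ring_unit_def)
qed

text \<open>The points distant from \<open>R(1,0)\<close> are parametrised by ring elements, so the
  quantifier over points turns into one over \<open>x\<close>.\<close>

lemma radically_parallel_1_0_iff:
  fixes c d :: "'a::ring_1"
  assumes "admissible (vector [c, d])"
  shows "radically_parallel (cyclic_submodule (vector [1, 0])) (cyclic_submodule (vector [c, d])) \<longleftrightarrow>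
           (\<forall>x. ring_unit (c - d * x))"
proof -
  have "cyclic_submodule (vector [x, 1]) \<in> projective_line" for x :: 'a
    using admissible_x_1 by (auto simp: projective_line_def)
  then have "radically_parallel (cyclic_submodule (vector [1, 0])) (cyclic_submodule (vector [c, d])) \<longleftrightarrow>
      (\<forall>x. distant (cyclic_submodule (vector [x, 1])) (cyclic_submodule (vector [c, d])))"
    by (auto simp: radically_parallel_def distant_1_0_iff)
  then show ?thesis
    by (simp add: distant_cyclic_iff admissible_x_1 assms invertible_x_1_iff)
qed

theorem theorem2p1:
  fixes q :: "('a::ring_1 ^ 2) set"
  assumes "q \<in> projective_line"
  shows "radically_parallel (cyclic_submodule (vector [1, 0])) q \<longleftrightarrow>
           (\<exists>b \<in> jacobson_radical. q = cyclic_submodule (vector [1, b]))"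
proof
  assume par: "radically_parallel (cyclic_submodule (vector [1, 0])) q"
  obtain c d where cd: "admissible (vector [c, d])" "q = cyclic_submodule (vector [c, d])"
  proof -
    obtain w where "admissible w" "q = cyclic_submodule w"
      using assms by (auto simp: projective_line_def)
    then show thesis
      using that[of "w $ 1" "w $ 2"] by (simp add: vector_2_eta)
  qed
  have units: "ring_unit (c - d * x)" for x
    using par cd radically_parallel_1_0_iff by blast
  obtain e where e: "c * e = 1" "e * c = 1"
    using units[of 0] by (auto simp: ring_unit_def)
  then have unit_e: "ring_unit e"
    by (auto simp: ring_unit_def)
  \<comment> \<open>Left multiplication of \<open>c - d * x\<close> by \<open>e\<close>, the inverse
    of \<open>c\<close>, matches the rescaling of \<open>(c, d)\<close> to
    \<open>(1, e * d)\<close>, which leaves the point unchanged.\<close>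
  have "ring_unit (1 - e * d * x)" for x
    using ring_unit_mult[OF unit_e units[of x]] by (simp add: right_diff_distrib e mult.assoc)
  then have "e * d \<in> jacobson_radical"
    by (simp add: jacobson_radical_iff_right)
  moreover have "vector [1, e * d] = e *s (vector [c, d] :: 'a ^ 2)"
    by (simp add: vec_eq_iff forall_2 e)
  then have "q = cyclic_submodule (vector [1, e * d])"
    using cd(2) cyclic_submodule_unit_smult[OF unit_e] by metis
  ultimately show "\<exists>b \<in> jacobson_radical. q = cyclic_submodule (vector [1, b])"
    by blast
next
  assume "\<exists>b \<in> jacobson_radical. q = cyclic_submodule (vector [1, b])"
  \<comment> \<open>For the pair \<open>(1, b)\<close> the unit criterion is literally the
    right-handed description of the radical.\<close>
  then show "radically_parallel (cyclic_submodule (vector [1, 0])) q"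
    by (auto simp: radically_parallel_1_0_iff admissible_1_x jacobson_radical_iff_right)
qed

end
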